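(* Let $R$ be a (commutative) Noetherian ring and $I$ a non-zero proper ideal of $R$. Assume that $I$ has no embedded primes, i.e. $\operatorname{Ass}(R/I)=\operatorname{Min}(I)$, and that $\operatorname{ht}(I)\ge 1$. Let $t \ge 1$ be an integer and $N_t = I^{(t)}/I^{(t+1)}$. Then $$\operatorname{Ass}(N_t)=\operatorname{Ass}(R/I)=\operatorname{Min}(I).$$
   Context: For an ideal $I$ of a Noetherian ring $R$ and $t\ge 1$, the $t$-th symbolic power is $I^{(t)}=\left(\bigcap_{P\in \operatorname{Ass}(R/I)} I^tR_P\right)\cap R$, i.e. the set of $r\in R$ whose image in $R_P$ lies in $I^tR_P$ for every $P\in\operatorname{Ass}(R/I)$. $\operatorname{Min}(I)$ is the set of minimal primes of $I$. *)

theory Defs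
  imports "HOL-Library.Extended_Nat" "HOL-Algebra.Module" "HOL-Algebra.Ring_Divisibility"
    "HOL-Algebra.Ideal_Product"
begin

section \<open>Modules: quotients and associated primes\<close>

definition self_module :: "('a, 'b) ring_scheme \<Rightarrow> ('a, 'a) module"
  where "self_module R =
    \<lparr>carrier = carrier R, monoid.mult = monoid.mult R, one = \<one>\<^bsub>R\<^esub>,
     ring.zero = \<zero>\<^bsub>R\<^esub>, ring.add = ring.add R,
     smult = monoid.mult R\<rparr>"

text \<open>The library's module records extend ring records, but the module axioms do not involve
  the fields \<open>mult\<close> and \<open>one\<close>; these carry no information in a quotient
  module. The scalar action takes a coset \<open>N + x\<close> to \<open>N + r x\<close>.\<close>

definition quot_module :: "('a, 'm, 'c) module_scheme \<Rightarrow> 'm set \<Rightarrow> ('a, 'm set) module"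
  where "quot_module M N =
    \<lparr>carrier = a_rcosets\<^bsub>M\<^esub> N, monoid.mult = (\<lambda>_ _. undefined), one = undefined,
     ring.zero = N, ring.add = set_add M,
     smult = (\<lambda>r X. \<Union>x\<in>X. N +>\<^bsub>M\<^esub> (r \<odot>\<^bsub>M\<^esub> x))\<rparr>"

definition annihilator :: "('a, 'b) ring_scheme \<Rightarrow> ('a, 'm, 'c) module_scheme \<Rightarrow> 'm \<Rightarrow> 'a set"
  where "annihilator R M m = {r \<in> carrier R. r \<odot>\<^bsub>M\<^esub> m = \<zero>\<^bsub>M\<^esub>}"

definition assoc_primes :: "('a, 'b) ring_scheme \<Rightarrow> ('a, 'm, 'c) module_scheme \<Rightarrow> 'a set set"
  where "assoc_primes R M = {P. primeideal P R \<and> (\<exists>m\<in>carrier M. P = annihilator R M m)}"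

definition minimal_primes :: "('a, 'b) ring_scheme \<Rightarrow> 'a set \<Rightarrow> 'a set set"
  where "minimal_primes R I =
    {P. primeideal P R \<and> I \<subseteq> P \<and> (\<forall>Q. primeideal Q R \<and> I \<subseteq> Q \<and> Q \<subseteq> P \<longrightarrow> Q = P)}"


section \<open>Height\<close>

definition prime_height :: "('a, 'b) ring_scheme \<Rightarrow> 'a set \<Rightarrow> enat"
  where "prime_height R P =
    Sup {enat n | n. \<exists>C :: nat \<Rightarrow> 'a set.
      (\<forall>i\<le>n. primeideal (C i) R) \<and> (\<forall>i<n. C i \<subset> C (Suc i)) \<and> C n = P}"

definition height :: "('a, 'b) ring_scheme \<Rightarrow> 'a set \<Rightarrow> enat"
  where "height R I = (INF P \<in> {P. primeideal P R \<and> I \<subseteq> P}. prime_height R P)"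


section \<open>Localization\<close>

definition frac_rel :: "('a, 'b) ring_scheme \<Rightarrow> 'a set \<Rightarrow> (('a \<times> 'a) \<times> ('a \<times> 'a)) set"
  where "frac_rel R S =
    {((a, s), (b, t)) | a s b t. a \<in> carrier R \<and> s \<in> S \<and> b \<in> carrier R \<and> t \<in> S \<and>
       (\<exists>u\<in>S. u \<otimes>\<^bsub>R\<^esub> (t \<otimes>\<^bsub>R\<^esub> a) = u \<otimes>\<^bsub>R\<^esub> (s \<otimes>\<^bsub>R\<^esub> b))}"

definition loc_frac :: "('a, 'b) ring_scheme \<Rightarrow> 'a set \<Rightarrow> 'a \<Rightarrow> 'a \<Rightarrow> ('a \<times> 'a) set"
  where "loc_frac R S a s = frac_rel R S `` {(a, s)}"

text \<open>Addition and multiplication of classes are computed on representatives; the unions below are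
  over all choices of representatives, which give the same class when \<open>S\<close> is
  multiplicatively closed (see \<open>add_frac\<close> and \<open>mult_frac\<close>).\<close>

definition localization :: "('a, 'b) ring_scheme \<Rightarrow> 'a set \<Rightarrow> ('a \<times> 'a) set ring"
  where "localization R S =
    \<lparr>carrier = (carrier R \<times> S) // frac_rel R S,
     monoid.mult = (\<lambda>X Y. \<Union>(a, s)\<in>X. \<Union>(b, t)\<in>Y. loc_frac R S (a \<otimes>\<^bsub>R\<^esub> b) (s \<otimes>\<^bsub>R\<^esub> t)),
     one = loc_frac R S \<one>\<^bsub>R\<^esub> \<one>\<^bsub>R\<^esub>,
     ring.zero = loc_frac R S \<zero>\<^bsub>R\<^esub> \<one>\<^bsub>R\<^esub>,
     ring.add = (\<lambda>X Y. \<Union>(a, s)\<in>X. \<Union>(b, t)\<in>Y.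
       loc_frac R S ((t \<otimes>\<^bsub>R\<^esub> a) \<oplus>\<^bsub>R\<^esub> (s \<otimes>\<^bsub>R\<^esub> b)) (s \<otimes>\<^bsub>R\<^esub> t))\<rparr>"

definition loc_map :: "('a, 'b) ring_scheme \<Rightarrow> 'a set \<Rightarrow> 'a \<Rightarrow> ('a \<times> 'a) set"
  where "loc_map R S a = loc_frac R S a \<one>\<^bsub>R\<^esub>"


section \<open>Symbolic powers\<close>

definition ext_ideal :: "('a, 'b) ring_scheme \<Rightarrow> 'a set \<Rightarrow> 'a set \<Rightarrow> ('a \<times> 'a) set set"
  where "ext_ideal R S J = Idl\<^bsub>localization R S\<^esub> (loc_map R S ` J)"

definition symbolic_power :: "('a, 'b) ring_scheme \<Rightarrow> 'a set \<Rightarrow> nat \<Rightarrow> 'a set"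
  where "symbolic_power R I t =
    {r \<in> carrier R. \<forall>P \<in> assoc_primes R (quot_module (self_module R) I).
       loc_map R (carrier R - P) r \<in> ext_ideal R (carrier R - P) (I [^]\<^bsub>ideals_set R\<^esub> t)}"

definition symbolic_quotient :: "('a, 'b) ring_scheme \<Rightarrow> 'a set \<Rightarrow> nat \<Rightarrow> ('a, 'a set) module"
  where "symbolic_quotient R I t =
    quot_module ((self_module R)\<lparr>carrier := symbolic_power R I t\<rparr>) (symbolic_power R I (Suc t))"


section \<open>The constructions are well defined\<close>

lemma (in cring) self_module_is_module: "module R (self_module R)"
proof (rule moduleI)
  show "cring R" by (rule cring_axioms)
  show "abelian_group (self_module R)"
  proof (rule abelian_groupI)
    show "\<exists>y\<in>carrier (self_module R). y \<oplus>\<^bsub>self_module R\<^esub> x = \<zero>\<^bsub>self_module R\<^esub>"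
      if "x \<in> carrier (self_module R)" for x
      using that l_neg by (auto simp: self_module_def intro!: bexI[of _ "\<ominus> x"])
  qed (auto simp: self_module_def a_ac)
qed (auto simp: self_module_def l_distr r_distr m_assoc)

lemma (in module) smult_coset:
  assumes N: "submodule N R M" and r: "r \<in> carrier R" and x: "x \<in> carrier M"
  shows "r \<odot>\<^bsub>quot_module M N\<^esub> (N +>\<^bsub>M\<^esub> x) = N +>\<^bsub>M\<^esub> (r \<odot>\<^bsub>M\<^esub> x)"
proof -
  interpret N: additive_subgroup N M
    using N by (simp add: additive_subgroup_def submodule_def)
  interpret N: abelian_subgroup N M
    by (rule abelian_subgroupI3[OF N.additive_subgroup_axioms M.abelian_group_axioms])
  have eq: "N +>\<^bsub>M\<^esub> (r \<odot>\<^bsub>M\<^esub> y) = N +>\<^bsub>M\<^esub> (r \<odot>\<^bsub>M\<^esub> x)" if y: "y \<in> N +>\<^bsub>M\<^esub> x" for y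
  proof -
    obtain n where n: "n \<in> N" "y = n \<oplus>\<^bsub>M\<^esub> x"
      using y by (auto simp: a_r_coset_def')
    have nc: "n \<in> carrier M" using n by (simp add: N.a_Hcarr)
    have "r \<odot>\<^bsub>M\<^esub> y = r \<odot>\<^bsub>M\<^esub> n \<oplus>\<^bsub>M\<^esub> r \<odot>\<^bsub>M\<^esub> x"
      using n nc r x by (simp add: smult_r_distr)
    moreover have "r \<odot>\<^bsub>M\<^esub> n \<in> N"
      using submodule.smult_closed[OF N r] n by simp
    ultimately have "r \<odot>\<^bsub>M\<^esub> y \<in> N +>\<^bsub>M\<^esub> (r \<odot>\<^bsub>M\<^esub> x)"
      by (auto simp: a_r_coset_def')
    then show ?thesis
      using r x by (metis smult_closed N.a_subgroup M.a_repr_independence)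
  qed
  have "x \<in> N +>\<^bsub>M\<^esub> x" using x by (rule N.a_rcos_self)
  then show ?thesis
    by (simp add: quot_module_def) (use eq in blast)
qed

lemma (in module) quot_module_is_module:
  assumes N: "submodule N R M"
  shows "module R (quot_module M N)"
proof -
  interpret N: additive_subgroup N M
    using N by (simp add: additive_subgroup_def submodule_def)
  interpret N: abelian_subgroup N M
    by (rule abelian_subgroupI3[OF N.additive_subgroup_axioms M.abelian_group_axioms])
  have carr: "\<exists>x\<in>carrier M. X = N +>\<^bsub>M\<^esub> x" if "X \<in> carrier (quot_module M N)" for X
    using that by (auto simp: quot_module_def A_RCOSETS_def')
  have mem: "N +>\<^bsub>M\<^esub> x \<in> carrier (quot_module M N)" if "x \<in> carrier M" for x
    using that by (auto simp: quot_module_def A_RCOSETS_def')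
  have add: "(N +>\<^bsub>M\<^esub> x) \<oplus>\<^bsub>quot_module M N\<^esub> (N +>\<^bsub>M\<^esub> y) = N +>\<^bsub>M\<^esub> (x \<oplus>\<^bsub>M\<^esub> y)"
    if "x \<in> carrier M" "y \<in> carrier M" for x y
    using that by (simp add: quot_module_def N.a_rcos_sum)
  note sm = smult_coset[OF N]
  show ?thesis
  proof (rule moduleI)
    show "cring R" by (rule R.cring_axioms)
    have zero: "\<zero>\<^bsub>quot_module M N\<^esub> = N +>\<^bsub>M\<^esub> \<zero>\<^bsub>M\<^esub>"
      by (simp add: quot_module_def M.a_coset_add_zero N.a_subset)
    show "abelian_group (quot_module M N)"
    proof (rule abelian_groupI)
      fix X assume "X \<in> carrier (quot_module M N)"
      then obtain x where x: "x \<in> carrier M" "X = N +>\<^bsub>M\<^esub> x" using carr by blast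
      then have "(N +>\<^bsub>M\<^esub> \<ominus>\<^bsub>M\<^esub> x) \<oplus>\<^bsub>quot_module M N\<^esub> X = \<zero>\<^bsub>quot_module M N\<^esub>"
        by (simp add: add zero M.l_neg)
      then show "\<exists>Y\<in>carrier (quot_module M N). Y \<oplus>\<^bsub>quot_module M N\<^esub> X = \<zero>\<^bsub>quot_module M N\<^esub>"
        using x mem by blast
    qed (auto dest!: carr simp: add mem zero M.a_ac)
  qed (auto dest!: carr simp: add sm mem smult_l_distr smult_r_distr smult_assoc1)
qed

lemma UN_pairs_const:
  fixes F :: "'a \<Rightarrow> 'b \<Rightarrow> 'c \<Rightarrow> 'd \<Rightarrow> 'e set"
  assumes x: "x \<in> X" and y: "y \<in> Y"
    and F: "\<And>a s b t. (a, s) \<in> X \<Longrightarrow> (b, t) \<in> Y \<Longrightarrow> F a s b t = C"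
  shows "(\<Union>(a, s)\<in>X. \<Union>(b, t)\<in>Y. F a s b t) = C"
proof -
  have "(\<Union>(a, s)\<in>X. \<Union>(b, t)\<in>Y. F a s b t) = (\<Union>p\<in>X. \<Union>q\<in>Y. C)"
  proof (rule SUP_cong[OF refl])
    fix p assume p: "p \<in> X"
    have "(case q of (b, t) \<Rightarrow> F (fst p) (snd p) b t) = C" if "q \<in> Y" for q
      using F[of "fst p" "snd p" "fst q" "snd q"] p that by (simp add: case_prod_beta)
    then have "(\<Union>(b, t)\<in>Y. F (fst p) (snd p) b t) = (\<Union>q\<in>Y. C)"
      by (rule SUP_cong[OF refl])
    then show "(case p of (a, s) \<Rightarrow> \<Union>(b, t)\<in>Y. F a s b t) = (\<Union>q\<in>Y. C)"
      by (simp only: case_prod_beta)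
  qed
  also have "\<dots> = C"
    using x y by auto
  finally show ?thesis .
qed

locale mult_set = cring R for R (structure) +
  fixes S
  assumes S_sub: "S \<subseteq> carrier R"
    and S_one: "\<one> \<in> S"
    and S_mult: "\<lbrakk>s \<in> S; t \<in> S\<rbrakk> \<Longrightarrow> s \<otimes> t \<in> S"
begin

lemma S_carr: "s \<in> S \<Longrightarrow> s \<in> carrier R"
  using S_sub by blast

lemma frac_rel_equiv: "equiv (carrier R \<times> S) (frac_rel R S)"
proof (rule equivI)
  show "frac_rel R S \<subseteq> (carrier R \<times> S) \<times> (carrier R \<times> S)"
    by (auto simp: frac_rel_def)
  show "refl_on (carrier R \<times> S) (frac_rel R S)"
    using S_one by (auto simp: refl_on_def frac_rel_def)
  show "sym (frac_rel R S)"
    by (auto simp: sym_def frac_rel_def) metis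
  show "trans (frac_rel R S)"
  proof (rule transI)
    fix x y z assume "(x, y) \<in> frac_rel R S" "(y, z) \<in> frac_rel R S"
    then obtain a s b t c v u w where
      eqs: "x = (a, s)" "y = (b, t)" "z = (c, v)"
      and abc: "a \<in> carrier R" "b \<in> carrier R" "c \<in> carrier R"
      and stv: "s \<in> S" "t \<in> S" "v \<in> S" and uw: "u \<in> S" "w \<in> S"
      and 1: "u \<otimes> (t \<otimes> a) = u \<otimes> (s \<otimes> b)" and 2: "w \<otimes> (v \<otimes> b) = w \<otimes> (t \<otimes> c)"
      by (fastforce simp: frac_rel_def)
    note c = abc stv[THEN S_carr] uw[THEN S_carr]
    have "(u \<otimes> w \<otimes> t) \<otimes> (v \<otimes> a) = w \<otimes> v \<otimes> (u \<otimes> (t \<otimes> a))"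
      using c by (simp add: m_ac)
    also have "\<dots> = u \<otimes> s \<otimes> (w \<otimes> (v \<otimes> b))"
      unfolding 1 using c by (simp add: m_ac)
    also have "\<dots> = (u \<otimes> w \<otimes> t) \<otimes> (s \<otimes> c)"
      unfolding 2 using c by (simp add: m_ac)
    finally have "\<exists>u\<in>S. u \<otimes> (v \<otimes> a) = u \<otimes> (s \<otimes> c)"
      using S_mult stv uw by blast
    then show "(x, z) \<in> frac_rel R S"
      using abc stv unfolding eqs frac_rel_def by simp
  qed
qed

lemma frac_eq_iff:
  assumes "a \<in> carrier R" "s \<in> S" "b \<in> carrier R" "t \<in> S"
  shows "loc_frac R S a s = loc_frac R S b t \<longleftrightarrow> (\<exists>u\<in>S. u \<otimes> (t \<otimes> a) = u \<otimes> (s \<otimes> b))"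
  unfolding loc_frac_def using eq_equiv_class_iff[OF frac_rel_equiv, of "(a, s)" "(b, t)"] assms
  by (auto simp: frac_rel_def)

lemma frac_memI: "\<lbrakk>a \<in> carrier R; s \<in> S\<rbrakk> \<Longrightarrow> (a, s) \<in> loc_frac R S a s"
  unfolding loc_frac_def using S_one by (auto simp: frac_rel_def)

lemma frac_memD:
  assumes "(b, t) \<in> loc_frac R S a s"
  shows "b \<in> carrier R" "t \<in> S" "\<exists>u\<in>S. u \<otimes> (t \<otimes> a) = u \<otimes> (s \<otimes> b)"
  using assms by (auto simp: loc_frac_def frac_rel_def)

lemma loc_carrier: "carrier (localization R S) = {loc_frac R S a s | a s. a \<in> carrier R \<and> s \<in> S}"
  by (auto simp: localization_def quotient_def loc_frac_def)

lemma mult_frac: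
  assumes a: "a \<in> carrier R" "s \<in> S" and b: "b \<in> carrier R" "t \<in> S"
  shows "loc_frac R S a s \<otimes>\<^bsub>localization R S\<^esub> loc_frac R S b t = loc_frac R S (a \<otimes> b) (s \<otimes> t)"
proof -
  have "loc_frac R S (a' \<otimes> b') (s' \<otimes> t') = loc_frac R S (a \<otimes> b) (s \<otimes> t)"
    if 1: "(a', s') \<in> loc_frac R S a s" and 2: "(b', t') \<in> loc_frac R S b t" for a' s' b' t'
  proof -
    obtain u w where uw: "u \<in> S" "w \<in> S"
      and e: "u \<otimes> (s' \<otimes> a) = u \<otimes> (s \<otimes> a')" "w \<otimes> (t' \<otimes> b) = w \<otimes> (t \<otimes> b')"
      using frac_memD[OF 1] frac_memD[OF 2] by blast
    note c = assms frac_memD(1,2)[OF 1] frac_memD(1,2)[OF 2] uw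
    note c' = c S_carr[OF \<open>s \<in> S\<close>] S_carr[OF \<open>t \<in> S\<close>] S_carr[OF \<open>s' \<in> S\<close>]
      S_carr[OF \<open>t' \<in> S\<close>] uw[THEN S_carr]
    have "(u \<otimes> w) \<otimes> ((s \<otimes> t) \<otimes> (a' \<otimes> b')) = (u \<otimes> (s \<otimes> a')) \<otimes> (w \<otimes> (t \<otimes> b'))"
      using c' by (simp add: m_ac)
    also have "\<dots> = (u \<otimes> w) \<otimes> ((s' \<otimes> t') \<otimes> (a \<otimes> b))"
      unfolding e[symmetric] using c' by (simp add: m_ac)
    finally show ?thesis
      using c S_mult by (subst frac_eq_iff) auto
  qed
  note * = UN_pairs_const[OF frac_memI[OF a] frac_memI[OF b] this]
  show ?thesis
    unfolding localization_def by (simp add: *)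
qed

lemma add_frac:
  assumes a: "a \<in> carrier R" "s \<in> S" and b: "b \<in> carrier R" "t \<in> S"
  shows "loc_frac R S a s \<oplus>\<^bsub>localization R S\<^esub> loc_frac R S b t =
    loc_frac R S ((t \<otimes> a) \<oplus> (s \<otimes> b)) (s \<otimes> t)"
proof -
  have "loc_frac R S ((t' \<otimes> a') \<oplus> (s' \<otimes> b')) (s' \<otimes> t') = loc_frac R S ((t \<otimes> a) \<oplus> (s \<otimes> b)) (s \<otimes> t)"
    if 1: "(a', s') \<in> loc_frac R S a s" and 2: "(b', t') \<in> loc_frac R S b t" for a' s' b' t'
  proof -
    obtain u w where uw: "u \<in> S" "w \<in> S"
      and e: "u \<otimes> (s' \<otimes> a) = u \<otimes> (s \<otimes> a')" "w \<otimes> (t' \<otimes> b) = w \<otimes> (t \<otimes> b')"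
      using frac_memD[OF 1] frac_memD[OF 2] by blast
    note c = assms frac_memD(1,2)[OF 1] frac_memD(1,2)[OF 2] uw
    note c' = c S_carr[OF \<open>s \<in> S\<close>] S_carr[OF \<open>t \<in> S\<close>] S_carr[OF \<open>s' \<in> S\<close>]
      S_carr[OF \<open>t' \<in> S\<close>] uw[THEN S_carr]
    have "(u \<otimes> w) \<otimes> ((s \<otimes> t) \<otimes> ((t' \<otimes> a') \<oplus> (s' \<otimes> b')))
        = (w \<otimes> t \<otimes> t') \<otimes> (u \<otimes> (s \<otimes> a')) \<oplus> (u \<otimes> s \<otimes> s') \<otimes> (w \<otimes> (t \<otimes> b'))"
      using c' by algebra
    also have "\<dots> = (u \<otimes> w) \<otimes> ((s' \<otimes> t') \<otimes> ((t \<otimes> a) \<oplus> (s \<otimes> b)))"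
      unfolding e[symmetric] using c' by algebra
    finally have eq: "(u \<otimes> w) \<otimes> ((s \<otimes> t) \<otimes> ((t' \<otimes> a') \<oplus> (s' \<otimes> b'))) =
      (u \<otimes> w) \<otimes> ((s' \<otimes> t') \<otimes> ((t \<otimes> a) \<oplus> (s \<otimes> b)))" .
    show ?thesis
    proof (subst frac_eq_iff)
      show "t' \<otimes> a' \<oplus> s' \<otimes> b' \<in> carrier R" "t \<otimes> a \<oplus> s \<otimes> b \<in> carrier R"
        using c' by simp_all
      show "s' \<otimes> t' \<in> S" "s \<otimes> t \<in> S"
        using c by (simp_all add: S_mult)
      show "\<exists>v\<in>S. v \<otimes> ((s \<otimes> t) \<otimes> ((t' \<otimes> a') \<oplus> (s' \<otimes> b'))) =
        v \<otimes> ((s' \<otimes> t') \<otimes> ((t \<otimes> a) \<oplus> (s \<otimes> b)))"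
        using eq S_mult[OF uw] by blast
    qed
  qed
  note * = UN_pairs_const[OF frac_memI[OF a] frac_memI[OF b] this]
  show ?thesis
    unfolding localization_def by (simp add: *)
qed

end

lemma (in primeideal) mult_set_complement: "mult_set R (carrier R - I)"
proof (intro mult_set.intro mult_set_axioms.intro)
  show "cring R" by (rule is_cring)
  show "\<one> \<in> carrier R - I"
    using I_notcarr one_imp_carrier by auto
  show "s \<otimes> t \<in> carrier R - I" if "s \<in> carrier R - I" "t \<in> carrier R - I" for s t
    using that I_prime[of s t] by blast
qed blast

context mult_set
begin

lemma zero_localization: "\<zero>\<^bsub>localization R S\<^esub> = loc_frac R S \<zero> \<one>"
  and one_localization: "\<one>\<^bsub>localization R S\<^esub> = loc_frac R S \<one> \<one>"
  by (simp_all add: localization_def)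

lemma localization_cring: "cring (localization R S)"
proof -
  let ?L = "localization R S"
  have frac_cases: "\<exists>a\<in>carrier R. \<exists>s\<in>S. x = loc_frac R S a s" if "x \<in> carrier ?L" for x
    using that by (auto simp: loc_carrier)
  have frac_mem: "loc_frac R S a s \<in> carrier ?L" if "a \<in> carrier R" "s \<in> S" for a s
    using that by (auto simp: loc_carrier)
  have eqI: "loc_frac R S a s = loc_frac R S b t"
    if "a \<in> carrier R" "s \<in> S" "b \<in> carrier R" "t \<in> S" "t \<otimes> a = s \<otimes> b" for a s b t
    using that S_one by (subst frac_eq_iff) auto
  note ops = mult_frac add_frac S_mult S_carr S_one zero_localization one_localization frac_mem
  have ab: "abelian_group ?L"
  proof (rule abelian_groupI)
    fix x assume "x \<in> carrier ?L"
    then obtain a s where x: "x = loc_frac R S a s" "a \<in> carrier R" "s \<in> S"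
      using frac_cases by blast
    have "loc_frac R S (s \<otimes> \<ominus> a \<oplus> s \<otimes> a) (s \<otimes> s) = loc_frac R S \<zero> \<one>"
      using x by (intro eqI) (simp_all add: ops r_minus l_neg)
    then have "loc_frac R S (\<ominus> a) s \<oplus>\<^bsub>?L\<^esub> x = \<zero>\<^bsub>?L\<^esub>"
      using x by (simp add: ops)
    then show "\<exists>y\<in>carrier ?L. y \<oplus>\<^bsub>?L\<^esub> x = \<zero>\<^bsub>?L\<^esub>"
      using x frac_mem by blast
    show "\<zero>\<^bsub>?L\<^esub> \<oplus>\<^bsub>?L\<^esub> x = x"
      using x by (simp add: ops)
  next
    fix x y assume "x \<in> carrier ?L" "y \<in> carrier ?L"
    then obtain a s b t where x: "x = loc_frac R S a s" "a \<in> carrier R" "s \<in> S"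
      and y: "y = loc_frac R S b t" "b \<in> carrier R" "t \<in> S"
      using frac_cases by metis
    show "x \<oplus>\<^bsub>?L\<^esub> y \<in> carrier ?L"
      using x y by (simp add: ops)
    show "x \<oplus>\<^bsub>?L\<^esub> y = y \<oplus>\<^bsub>?L\<^esub> x"
      using x y by (simp add: ops m_comm a_comm)
    fix z assume "z \<in> carrier ?L"
    then obtain c u where z: "z = loc_frac R S c u" "c \<in> carrier R" "u \<in> S"
      using frac_cases by metis
    show "x \<oplus>\<^bsub>?L\<^esub> y \<oplus>\<^bsub>?L\<^esub> z = x \<oplus>\<^bsub>?L\<^esub> (y \<oplus>\<^bsub>?L\<^esub> z)"
      proof -
      note carr = x(2) y(2) z(2) S_carr[OF x(3)] S_carr[OF y(3)] S_carr[OF z(3)]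
      have "u \<otimes> (t \<otimes> a \<oplus> s \<otimes> b) \<oplus> s \<otimes> t \<otimes> c = t \<otimes> u \<otimes> a \<oplus> s \<otimes> (u \<otimes> b \<oplus> t \<otimes> c)"
        using carr by algebra
      moreover have "s \<otimes> t \<otimes> u = s \<otimes> (t \<otimes> u)"
        using carr by (simp add: m_assoc)
      ultimately show ?thesis
        using x y z by (simp add: ops del: m_assoc)
    qed
  next
    show "\<zero>\<^bsub>?L\<^esub> \<in> carrier ?L" by (simp add: ops)
  qed
  have cm: "comm_monoid ?L"
  proof (rule comm_monoidI)
    fix x y assume "x \<in> carrier ?L" "y \<in> carrier ?L"
    then obtain a s b t where x: "x = loc_frac R S a s" "a \<in> carrier R" "s \<in> S"
      and y: "y = loc_frac R S b t" "b \<in> carrier R" "t \<in> S"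
      using frac_cases by metis
    show "x \<otimes>\<^bsub>?L\<^esub> y \<in> carrier ?L"
      using x y by (simp add: ops)
    show "x \<otimes>\<^bsub>?L\<^esub> y = y \<otimes>\<^bsub>?L\<^esub> x"
      using x y by (simp add: ops m_comm)
    fix z assume "z \<in> carrier ?L"
    then obtain c u where z: "z = loc_frac R S c u" "c \<in> carrier R" "u \<in> S"
      using frac_cases by metis
    show "x \<otimes>\<^bsub>?L\<^esub> y \<otimes>\<^bsub>?L\<^esub> z = x \<otimes>\<^bsub>?L\<^esub> (y \<otimes>\<^bsub>?L\<^esub> z)"
      using x y z by (simp add: ops m_assoc)
  next
    fix x assume "x \<in> carrier ?L"
    then obtain a s where x: "x = loc_frac R S a s" "a \<in> carrier R" "s \<in> S"
      using frac_cases by blast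
    show "\<one>\<^bsub>?L\<^esub> \<otimes>\<^bsub>?L\<^esub> x = x"
      using x by (simp add: ops)
  next
    show "\<one>\<^bsub>?L\<^esub> \<in> carrier ?L" by (simp add: ops)
  qed
  have distr: "(x \<oplus>\<^bsub>?L\<^esub> y) \<otimes>\<^bsub>?L\<^esub> z = x \<otimes>\<^bsub>?L\<^esub> z \<oplus>\<^bsub>?L\<^esub> y \<otimes>\<^bsub>?L\<^esub> z"
    if xyz: "x \<in> carrier ?L" "y \<in> carrier ?L" "z \<in> carrier ?L" for x y z
  proof -
    obtain a s where x: "x = loc_frac R S a s" "a \<in> carrier R" "s \<in> S"
      using frac_cases[OF xyz(1)] by blast
    obtain b t where y: "y = loc_frac R S b t" "b \<in> carrier R" "t \<in> S"
      using frac_cases[OF xyz(2)] by blast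
    obtain c u where z: "z = loc_frac R S c u" "c \<in> carrier R" "u \<in> S"
      using frac_cases[OF xyz(3)] by blast
    have "loc_frac R S ((t \<otimes> a \<oplus> s \<otimes> b) \<otimes> c) (s \<otimes> t \<otimes> u) =
        loc_frac R S ((t \<otimes> u) \<otimes> (a \<otimes> c) \<oplus> (s \<otimes> u) \<otimes> (b \<otimes> c)) ((s \<otimes> u) \<otimes> (t \<otimes> u))"
    proof (rule eqI)
      note carr = x(2) y(2) z(2) S_carr[OF x(3)] S_carr[OF y(3)] S_carr[OF z(3)]
      show "(s \<otimes> u) \<otimes> (t \<otimes> u) \<otimes> ((t \<otimes> a \<oplus> s \<otimes> b) \<otimes> c) =
          s \<otimes> t \<otimes> u \<otimes> ((t \<otimes> u) \<otimes> (a \<otimes> c) \<oplus> (s \<otimes> u) \<otimes> (b \<otimes> c))"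
        using carr by algebra
    qed (use x y z in \<open>simp_all add: ops\<close>)
    then show ?thesis
      using x y z by (simp add: ops)
  qed
  show ?thesis
    by (rule cringI[OF ab cm distr])
qed

lemma loc_map_hom: "loc_map R S \<in> ring_hom R (localization R S)"
proof (rule ring_hom_memI)
  show "loc_map R S a \<in> carrier (localization R S)" if "a \<in> carrier R" for a
    using that S_one unfolding loc_map_def loc_carrier by blast
qed (simp_all add: loc_map_def mult_frac add_frac one_localization S_one)

end

end

theory Submission
  imports Defs
begin

text \<open>
  An element \<open>r\<close> lies in \<open>I\<^sup>(\<^sup>t\<^sup>)\<close> iff for each \<open>P \<in> Ass(R/I) = Min(I)\<close> some \<open>s \<notin> P\<close> satisfies
  \<open>s r \<in> I\<^sup>t\<close>. If \<open>Q\<close> is the annihilator of a class in \<open>N\<^sub>t\<close>, then \<open>I \<subseteq> Q\<close>, and \<open>Q \<subseteq> P\<close> for the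
  prime \<open>P \<in> Min(I)\<close> at which the class does not vanish; so \<open>Q = P\<close>.

  Conversely let \<open>P \<in> Min(I)\<close>. As \<open>P\<close> has positive height it contains a strictly smaller prime,
  which does not contain \<open>I\<close>; by Nakayama's lemma \<open>I\<^sup>t\<close> and \<open>I\<^sup>t\<^sup>+\<^sup>1\<close> differ at \<open>P\<close>. Among the
  \<open>r \<in> I\<^sup>t\<close> that are not in \<open>I\<^sup>t\<^sup>+\<^sup>1\<close> locally at \<open>P\<close>, choose one with \<open>(I\<^sup>t\<^sup>+\<^sup>1 : r)\<close> maximal. This ideal
  is prime and lies between \<open>I\<close> and \<open>P\<close>, hence equals \<open>P\<close>, and then \<open>P\<close> is also the annihilator
  of the class of \<open>r\<close> in \<open>N\<^sub>t\<close>.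
\<close>

section \<open>Ideals, colon ideals and maximal members of families\<close>

lemma (in cring) idealI_closed:
  assumes "J \<subseteq> carrier R" and "\<zero> \<in> J"
    and add: "\<And>x y. \<lbrakk>x \<in> J; y \<in> J\<rbrakk> \<Longrightarrow> x \<oplus> y \<in> J"
    and mult: "\<And>r x. \<lbrakk>r \<in> carrier R; x \<in> J\<rbrakk> \<Longrightarrow> r \<otimes> x \<in> J"
  shows "ideal J R"
proof (rule idealI)
  show "ring R" by (rule ring_axioms)
  show "subgroup J (add_monoid R)"
  proof
    fix x assume x: "x \<in> J"
    with assms(1) have xc: "x \<in> carrier R" by blast
    have "\<ominus> x = (\<ominus> \<one>) \<otimes> x" using xc by (simp add: l_minus)
    then show "inv\<^bsub>add_monoid R\<^esub> x \<in> J"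
      using mult[of "\<ominus> \<one>" x] x by (simp add: a_inv_def)
  qed (use assms in auto)
  show "a \<otimes> x \<in> J" if "a \<in> J" "x \<in> carrier R" for a x
    using that mult[of x a] assms(1) m_comm[of a x] by (simp add: subset_iff)
qed (use mult in blast)

text \<open>The ideal quotient \<open>(J : r)\<close>, the annihilator of the class of
  \<open>r\<close> modulo \<open>J\<close>. It lets associated primes of quotients be handled with
  elements of \<open>R\<close> instead of cosets.\<close>

definition colon :: "('a, 'b) ring_scheme \<Rightarrow> 'a set \<Rightarrow> 'a \<Rightarrow> 'a set"
  where "colon R J r = {x \<in> carrier R. x \<otimes>\<^bsub>R\<^esub> r \<in> J}"

lemma (in cring) colon_ideal:
  assumes "ideal J R" and "r \<in> carrier R"
  shows "ideal (colon R J r) R"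
proof -
  interpret J: ideal J R by fact
  show ?thesis
    by (rule idealI_closed)
      (use assms(2) in \<open>auto simp: colon_def l_distr m_assoc J.a_closed J.I_l_closed\<close>)
qed

text \<open>In a Noetherian ring a nonempty chain of ideals contains its union, which therefore
  serves as the upper bound in Zorn's lemma.\<close>

lemma (in noetherian_ring) maximal_ideal_in_family:
  assumes "F \<subseteq> {J. ideal J R}" and "F \<noteq> {}"
  shows "\<exists>M\<in>F. \<forall>J\<in>F. M \<subseteq> J \<longrightarrow> J = M"
proof (rule subset_Zorn)
  fix C assume C: "subset.chain F C"
  show "\<exists>U\<in>F. \<forall>J\<in>C. J \<subseteq> U"
  proof (cases "C = {}")
    case False
    have "subset.chain {J. ideal J R} C"
      using C assms(1) unfolding pred_on.chain_def by blast
    then have "\<Union>C \<in> C" by (rule ideal_chain_is_trivial[OF False])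
    moreover have "C \<subseteq> F" using C unfolding pred_on.chain_def by simp
    ultimately show ?thesis by (meson Union_upper subsetD)
  qed (use assms(2) in blast)
qed

section \<open>Extended ideals in a localization\<close>

text \<open>From right to left, \<open>1/s\<close> cancels \<open>s\<close>. From left to right, the
  fractions with numerator in \<open>J\<close> form an ideal containing the extension, and an
  equality of fractions supplies the factor in \<open>S\<close>.\<close>

lemma (in mult_set) loc_map_mem_ext_ideal_iff:
  assumes J: "ideal J R" and r: "r \<in> carrier R"
  shows "loc_map R S r \<in> ext_ideal R S J \<longleftrightarrow> (\<exists>s\<in>S. s \<otimes> r \<in> J)"
proof
  interpret J: ideal J R by fact
  interpret L: cring "localization R S" by (rule localization_cring)
  have img: "loc_map R S ` J \<subseteq> carrier (localization R S)"
    using J.Icarr S_one unfolding loc_map_def loc_carrier by blast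
  {
    assume "\<exists>s\<in>S. s \<otimes> r \<in> J"
    then obtain s where s: "s \<in> S" "s \<otimes> r \<in> J" by blast
    interpret E: ideal "ext_ideal R S J" "localization R S"
      unfolding ext_ideal_def by (rule L.genideal_ideal[OF img])
    have "loc_map R S (s \<otimes> r) \<in> ext_ideal R S J"
      unfolding ext_ideal_def using L.genideal_self[OF img] s by blast
    moreover have "loc_frac R S \<one> s \<in> carrier (localization R S)"
      using s by (auto simp: loc_carrier)
    ultimately have "loc_frac R S \<one> s \<otimes>\<^bsub>localization R S\<^esub> loc_map R S (s \<otimes> r) \<in> ext_ideal R S J"
      by (rule E.I_l_closed)
    moreover have "loc_frac R S \<one> s \<otimes>\<^bsub>localization R S\<^esub> loc_map R S (s \<otimes> r) = loc_map R S r"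
    proof -
      have "loc_frac R S (s \<otimes> r) s = loc_frac R S r \<one>"
        using s r S_one S_carr by (subst frac_eq_iff) auto
      then show ?thesis
        using s r S_one S_carr by (simp add: loc_map_def mult_frac)
    qed
    ultimately show "loc_map R S r \<in> ext_ideal R S J" by simp
  }
  let ?K = "{loc_frac R S a s | a s. a \<in> J \<and> s \<in> S}"
  have "ideal ?K (localization R S)"
  proof (rule L.idealI_closed)
    show "?K \<subseteq> carrier (localization R S)"
      using J.Icarr unfolding loc_carrier by blast
    show "\<zero>\<^bsub>localization R S\<^esub> \<in> ?K"
      using J.zero_closed S_one zero_localization by blast
  next
    fix x y assume "x \<in> ?K" "y \<in> ?K"
    then obtain a s b t where x: "x = loc_frac R S a s" "a \<in> J" "s \<in> S"
      and y: "y = loc_frac R S b t" "b \<in> J" "t \<in> S" by blast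
    have "x \<oplus>\<^bsub>localization R S\<^esub> y = loc_frac R S (t \<otimes> a \<oplus> s \<otimes> b) (s \<otimes> t)"
      using x y J.Icarr by (simp add: add_frac)
    moreover have "t \<otimes> a \<oplus> s \<otimes> b \<in> J" "s \<otimes> t \<in> S"
      using x y S_carr S_mult J.I_l_closed J.a_closed by simp_all
    ultimately show "x \<oplus>\<^bsub>localization R S\<^esub> y \<in> ?K" by blast
  next
    fix x y assume "x \<in> carrier (localization R S)" "y \<in> ?K"
    then obtain a s b t where x: "x = loc_frac R S a s" "a \<in> carrier R" "s \<in> S"
      and y: "y = loc_frac R S b t" "b \<in> J" "t \<in> S" by (auto simp: loc_carrier)
    have "x \<otimes>\<^bsub>localization R S\<^esub> y = loc_frac R S (a \<otimes> b) (s \<otimes> t)"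
      using x y J.Icarr by (simp add: mult_frac)
    moreover have "a \<otimes> b \<in> J" "s \<otimes> t \<in> S"
      using x y S_mult J.I_l_closed by simp_all
    ultimately show "x \<otimes>\<^bsub>localization R S\<^esub> y \<in> ?K" by blast
  qed
  moreover have "loc_map R S ` J \<subseteq> ?K"
    using S_one by (auto simp: loc_map_def)
  ultimately have "ext_ideal R S J \<subseteq> ?K"
    unfolding ext_ideal_def by (rule L.genideal_minimal)
  moreover assume "loc_map R S r \<in> ext_ideal R S J"
  ultimately obtain a s where a: "a \<in> J" "s \<in> S" and eq: "loc_frac R S r \<one> = loc_frac R S a s"
    by (auto simp: loc_map_def)
  from eq obtain u where u: "u \<in> S" "u \<otimes> (s \<otimes> r) = u \<otimes> (\<one> \<otimes> a)"
    using frac_eq_iff[of r \<one> a s] a r S_one J.Icarr by blast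
  have "(u \<otimes> s) \<otimes> r = u \<otimes> a"
    using u a r S_carr J.Icarr by (simp add: m_assoc)
  then have "(u \<otimes> s) \<otimes> r \<in> J"
    using u a S_carr J.I_l_closed by simp
  then show "\<exists>s\<in>S. s \<otimes> r \<in> J"
    using S_mult u a by blast
qed

section \<open>Associated primes of a quotient of ideals\<close>

lemma (in cring) assoc_primes_quot_module:
  assumes N: "ideal N R" and J: "J \<subseteq> carrier R"
  shows "assoc_primes R (quot_module ((self_module R)\<lparr>carrier := J\<rparr>) N) =
    {P. primeideal P R \<and> (\<exists>x\<in>J. P = colon R N x)}"
proof -
  interpret N: ideal N R by fact
  let ?M = "(self_module R)\<lparr>carrier := J\<rparr>"
  have coset: "N +>\<^bsub>?M\<^esub> x = N +> x" for x
    by (simp add: a_r_coset_def' self_module_def)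
  have eq_N: "N +> x = N \<longleftrightarrow> x \<in> N" if "x \<in> carrier R" for x
    using that N.rcos_const_imp_mem N.a_rcos_const by blast
  have smult: "r \<odot>\<^bsub>quot_module ?M N\<^esub> X = (\<Union>y\<in>X. N +> (r \<otimes> y))" for r X
    unfolding quot_module_def coset by (simp add: self_module_def)
  have "annihilator R (quot_module ?M N) (N +> x) = colon R N x" if x: "x \<in> J" for x
  proof -
    have xc: "x \<in> carrier R" using x J by blast
    have "r \<odot>\<^bsub>quot_module ?M N\<^esub> (N +> x) = N +> (r \<otimes> x)" if r: "r \<in> carrier R" for r
    proof -
      \<comment> \<open>Replacing \<open>x\<close> by \<open>n \<oplus> x\<close> adds
        \<open>r \<otimes> n\<close>, which is in \<open>N\<close>, so the union that defines the
        action collapses to a single coset.\<close>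
      have "N +> (r \<otimes> y) = N +> (r \<otimes> x)" if y: "y \<in> N +> x" for y
      proof -
        obtain n where n: "n \<in> N" "y = n \<oplus> x"
          using y by (auto simp: a_r_coset_def')
        then have "r \<otimes> y = r \<otimes> n \<oplus> r \<otimes> x"
          using r xc N.Icarr by (simp add: r_distr)
        moreover have "r \<otimes> n \<in> N" using n r by (simp add: N.I_l_closed)
        ultimately have "r \<otimes> y \<in> N +> (r \<otimes> x)"
          by (auto simp: a_r_coset_def')
        then show ?thesis
          using r xc by (metis m_closed N.a_subgroup a_repr_independence)
      qed
      moreover have "x \<in> N +> x" by (rule N.a_rcos_self[OF xc])
      ultimately show ?thesis unfolding smult by blast
    qed
    moreover have "\<zero>\<^bsub>quot_module ?M N\<^esub> = N" by (simp add: quot_module_def)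
    ultimately have "r \<odot>\<^bsub>quot_module ?M N\<^esub> (N +> x) = \<zero>\<^bsub>quot_module ?M N\<^esub> \<longleftrightarrow> r \<otimes> x \<in> N"
      if "r \<in> carrier R" for r
      using that xc by (simp only: eq_N m_closed)
    then show ?thesis
      unfolding annihilator_def colon_def by blast
  qed
  moreover have "carrier (quot_module ?M N) = (\<lambda>x. N +> x) ` J"
  proof -
    have "carrier (quot_module ?M N) = (\<Union>x\<in>J. {N +>\<^bsub>?M\<^esub> x})"
      by (simp add: quot_module_def A_RCOSETS_def')
    then show ?thesis unfolding coset by blast
  qed
  ultimately show ?thesis
    unfolding assoc_primes_def by auto
qed

section \<open>Powers of ideals and Nakayama's lemma\<close>

lemma (in cring) ideal_pow_ideal:
  assumes "ideal I R"
  shows "ideal (I [^]\<^bsub>ideals_set R\<^esub> (n::nat)) R"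
proof -
  interpret S: comm_monoid "ideals_set R" by (rule ideals_set_is_comm_monoid)
  show ?thesis
    using S.nat_pow_closed[of I n] assms by (simp add: ideals_set_def)
qed

lemma ideal_pow_Suc:
  "I [^]\<^bsub>ideals_set R\<^esub> Suc n = ideal_prod R (I [^]\<^bsub>ideals_set R\<^esub> n) I"
  by (simp add: nat_pow_def ideals_set_def)

text \<open>Elements of \<open>J ^ n\<close> and of \<open>J\<close> outside the prime would have a
  product in \<open>J ^ (n + 1)\<close> outside it. So a prime that does not contain
  \<open>I\<close> does not contain \<open>I ^ t\<close> either, as the use of Nakayama's lemma
  requires.\<close>

lemma (in primeideal) ideal_pow_subsetD:
  assumes J: "ideal J R" and sub: "J [^]\<^bsub>ideals_set R\<^esub> (n::nat) \<subseteq> I"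
  shows "J \<subseteq> I"
  using sub
proof (induction n)
  case 0
  then show ?case
    using I_notcarr Icarr by (auto simp: nat_pow_def ideals_set_def)
next
  case (Suc n)
  show ?case
  proof (rule ccontr)
    assume "\<not> J \<subseteq> I"
    then obtain x y where "x \<in> J" "x \<notin> I" "y \<in> J [^]\<^bsub>ideals_set R\<^esub> n" "y \<notin> I"
      using Suc.IH by blast
    moreover from this have "y \<otimes> x \<in> I"
      using Suc.prems ideal_prod.prod[of y "J [^]\<^bsub>ideals_set R\<^esub> n" x J R]
      unfolding ideal_pow_Suc by blast
    ultimately show False
      using I_prime ideal.Icarr[OF J] ideal.Icarr[OF ideal_pow_ideal[OF J]] by blast
  qed
qed

text \<open>Nakayama's lemma without generators: if \<open>N\<close> is maximal among the ideals that do not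
  contain \<open>M\<close> locally at \<open>P\<close> (\<open>Q\<close> is one of them), then \<open>N\<close> contains \<open>M I\<close> locally at \<open>P\<close>.\<close>

lemma (in cring) exists_not_locally_mem_ideal_prod:
  assumes "noetherian_ring R" and "primeideal P R" and "primeideal Q R" and "Q \<subseteq> P"
    and "ideal M R" and "\<not> M \<subseteq> Q" and "ideal I R" and "I \<subseteq> P"
  obtains m where "m \<in> M" and "\<And>s. s \<in> carrier R - P \<Longrightarrow> s \<otimes> m \<notin> ideal_prod R M I"
proof -
  interpret noetherian_ring R by fact
  interpret P: primeideal P R by fact
  interpret Q: primeideal Q R by fact
  interpret M: ideal M R by fact
  interpret I: ideal I R by fact
  interpret C: mult_set R "carrier R - P" by (rule P.mult_set_complement)
  let ?S = "carrier R - P"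
  define F where "F = {N. ideal N R \<and> (\<exists>m\<in>M. \<forall>s\<in>?S. s \<otimes> m \<notin> N)}"
  obtain q where "q \<in> M" "q \<notin> Q" using assms(6) by blast
  \<comment> \<open>As \<open>Q\<close> is prime and \<open>q\<close> is not in it,
    \<open>s \<otimes> q\<close> in \<open>Q\<close> would put \<open>s\<close> in \<open>Q\<close>,
    hence in \<open>P\<close>.\<close>
  then have "\<forall>s\<in>?S. s \<otimes> q \<notin> Q"
    using Q.I_prime[of _ q] M.Icarr assms(4) by blast
  with \<open>q \<in> M\<close> have "F \<noteq> {}" using Q.is_ideal unfolding F_def by blast
  moreover have "F \<subseteq> {J. ideal J R}" unfolding F_def by blast
  ultimately obtain N where N: "N \<in> F" and max: "\<And>J. \<lbrakk>J \<in> F; N \<subseteq> J\<rbrakk> \<Longrightarrow> J = N"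
    using maximal_ideal_in_family[of F] by blast
  interpret N: ideal N R using N by (simp add: F_def)
  obtain m where m: "m \<in> M" "\<And>s. s \<in> ?S \<Longrightarrow> s \<otimes> m \<notin> N"
    using N unfolding F_def by blast
  have gen: "\<exists>s\<in>?S. s \<otimes> (x \<otimes> a) \<in> N" if x: "x \<in> M" and a: "a \<in> I" for x a
  proof (rule ccontr)
    assume not: "\<not> ?thesis"
    have c: "x \<in> carrier R" "a \<in> carrier R" using x a M.Icarr I.Icarr by auto
    \<comment> \<open>If \<open>x \<otimes> a\<close> is not locally in \<open>N\<close>, adjoining
      it enlarges \<open>N\<close>, so by maximality the larger ideal contains \<open>M\<close>
      locally at \<open>P\<close>.\<close>
    let ?K = "set_add R N (PIdl (x \<otimes> a))"
    have "ideal ?K R"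
      using c by (intro add_ideals N.is_ideal cgenideal_ideal) simp
    moreover have "N \<subseteq> ?K"
    proof
      fix n assume "n \<in> N"
      then have "n \<oplus> \<zero> \<otimes> (x \<otimes> a) \<in> ?K"
        unfolding set_add_def' cgenideal_def by blast
      then show "n \<in> ?K" using c N.Icarr[OF \<open>n \<in> N\<close>] by simp
    qed
    moreover have "x \<otimes> a \<in> ?K"
    proof -
      have "\<zero> \<oplus> \<one> \<otimes> (x \<otimes> a) \<in> ?K"
        unfolding set_add_def' cgenideal_def using N.zero_closed by blast
      then show ?thesis using c by simp
    qed
    moreover have "x \<otimes> a \<notin> N"
      using not C.S_one c by (metis l_one m_closed)
    ultimately have "?K \<notin> F" using max[of ?K] by blast
    then obtain s where s: "s \<in> ?S" "s \<otimes> x \<in> ?K"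
      using x \<open>ideal ?K R\<close> unfolding F_def by blast
    then obtain n y where n: "n \<in> N" "y \<in> carrier R" "s \<otimes> x = n \<oplus> y \<otimes> (x \<otimes> a)"
      unfolding set_add_def' cgenideal_def by blast
    \<comment> \<open>From \<open>s x = n + y x a\<close> follows \<open>(s - y a) x = n\<close>.
      Since \<open>a\<close> is in \<open>P\<close> and \<open>s\<close> is not,
      \<open>s - y a\<close> stays outside \<open>P\<close>; it plays the part of the unit in the
      usual proof of Nakayama's lemma.\<close>
    let ?s = "s \<ominus> y \<otimes> a"
    have sc: "s \<in> carrier R" "?s \<in> carrier R" and nc: "n \<in> carrier R"
      using s n c N.Icarr by auto
    have "y \<otimes> a \<in> P" using n a assms(8) P.I_l_closed by blast
    moreover have "s = ?s \<oplus> y \<otimes> a" using sc n c by algebra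
    ultimately have "?s \<in> ?S" using s sc P.a_closed by (metis DiffD2 DiffI)
    moreover have "?s \<otimes> x = n"
    proof -
      have "?s \<otimes> x = s \<otimes> x \<ominus> y \<otimes> (x \<otimes> a)" using sc n(2) c by algebra
      also have "\<dots> = n" unfolding n(3) using nc n(2) c by algebra
      finally show ?thesis .
    qed
    then have "?s \<otimes> (x \<otimes> a) = n \<otimes> a" using sc c by (simp add: m_assoc[symmetric])
    then have "?s \<otimes> (x \<otimes> a) \<in> N" using N.I_r_closed[OF n(1) c(2)] by simp
    ultimately show False using not by blast
  qed
  \<comment> \<open>For a sum, the product of the two multipliers works and is again outside
    \<open>P\<close>.\<close>
  have loc: "\<exists>s\<in>?S. s \<otimes> z \<in> N" if "z \<in> ideal_prod R M I" for z
    using that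
  proof induction
    case (prod i j)
    then show ?case by (rule gen)
  next
    case (sum z w)
    then obtain s u where su: "s \<in> ?S" "s \<otimes> z \<in> N" "u \<in> ?S" "u \<otimes> w \<in> N" by blast
    have zw: "z \<in> carrier R" "w \<in> carrier R"
      using sum.hyps ideal_prod_in_carrier[OF assms(5,7)] by auto
    have "(s \<otimes> u) \<otimes> (z \<oplus> w) = u \<otimes> (s \<otimes> z) \<oplus> s \<otimes> (u \<otimes> w)"
      using zw C.S_carr su by algebra
    also have "\<dots> \<in> N" using su C.S_carr N.I_l_closed N.a_closed by simp
    finally show ?case using C.S_mult su by blast
  qed
  show thesis
  proof (rule that[OF m(1)])
    fix s assume s: "s \<in> ?S"
    show "s \<otimes> m \<notin> ideal_prod R M I"
    proof
      assume "s \<otimes> m \<in> ideal_prod R M I"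
      then obtain u where "u \<in> ?S" "u \<otimes> (s \<otimes> m) \<in> N" using loc by blast
      then show False
        using m(2)[of "u \<otimes> s"] s C.S_mult C.S_carr M.Icarr[OF m(1)] by (simp add: m_assoc)
    qed
  qed
qed

section \<open>Prime colon ideals\<close>

text \<open>The usual argument that a maximal annihilator is prime, restricted to elements of
  \<open>M\<close> that are not in \<open>A\<close> locally at \<open>P\<close>; the restriction
  keeps the colon ideal inside \<open>P\<close>.\<close>

lemma (in cring) exists_prime_colon:
  assumes "noetherian_ring R" and "primeideal P R" and "ideal M R" and "ideal A R"
    and m: "m \<in> M" "\<And>s. s \<in> carrier R - P \<Longrightarrow> s \<otimes> m \<notin> A"
  obtains r where "r \<in> M" and "primeideal (colon R A r) R" and "colon R A r \<subseteq> P"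
proof -
  interpret noetherian_ring R by fact
  interpret P: primeideal P R by fact
  interpret M: ideal M R by fact
  interpret A: ideal A R by fact
  interpret C: mult_set R "carrier R - P" by (rule P.mult_set_complement)
  let ?S = "carrier R - P"
  define F where "F = {colon R A r | r. r \<in> M \<and> (\<forall>s\<in>?S. s \<otimes> r \<notin> A)}"
  have "F \<subseteq> {J. ideal J R}"
    using colon_ideal[OF assms(4)] M.Icarr unfolding F_def by blast
  moreover have "F \<noteq> {}" using m unfolding F_def by blast
  ultimately obtain B where "B \<in> F" and max: "\<And>J. \<lbrakk>J \<in> F; B \<subseteq> J\<rbrakk> \<Longrightarrow> J = B"
    using maximal_ideal_in_family[of F] by blast
  then obtain r where B: "B = colon R A r" and r: "r \<in> M" "\<And>s. s \<in> ?S \<Longrightarrow> s \<otimes> r \<notin> A"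
    unfolding F_def by blast
  have rc: "r \<in> carrier R" using r M.Icarr by blast
  \<comment> \<open>Replacing \<open>r\<close> by a multiple can only enlarge the colon ideal, so by
    maximality it stays the same as long as the multiple is not in \<open>A\<close> locally at
    \<open>P\<close>.\<close>
  have same: "colon R A (x \<otimes> r) = B" if x: "x \<in> carrier R" "\<And>s. s \<in> ?S \<Longrightarrow> s \<otimes> (x \<otimes> r) \<notin> A" for x
  proof (rule max)
    show "colon R A (x \<otimes> r) \<in> F"
      using x M.I_l_closed[OF r(1)] unfolding F_def by blast
    show "B \<subseteq> colon R A (x \<otimes> r)"
    proof
      fix y assume "y \<in> B"
      then have y: "y \<in> carrier R" "y \<otimes> r \<in> A" by (auto simp: B colon_def)
      have "x \<otimes> (y \<otimes> r) \<in> A" using x(1) by (rule A.I_l_closed[OF y(2)])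
      then show "y \<in> colon R A (x \<otimes> r)"
        using y x(1) rc m_lcomm[of x y r] by (simp add: colon_def)
    qed
  qed
  have sub: "colon R A r \<subseteq> P" using r(2) by (auto simp: colon_def)
  have "primeideal B R"
  proof (rule primeidealI)
    show "ideal B R" unfolding B by (rule colon_ideal[OF assms(4) rc])
    show "cring R" by (rule cring_axioms)
    show "carrier R \<noteq> B" using sub C.S_one unfolding B by blast
    fix y x assume y: "y \<in> carrier R" and x: "x \<in> carrier R" and "y \<otimes> x \<in> B"
    then have yx: "y \<otimes> (x \<otimes> r) \<in> A" using rc by (simp add: B colon_def m_assoc)
    show "y \<in> B \<or> x \<in> B"
    \<comment> \<open>If some \<open>s\<close> outside \<open>P\<close> sends
      \<open>x \<otimes> r\<close> into \<open>A\<close>, then \<open>x\<close> kills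
      \<open>s \<otimes> r\<close> modulo \<open>A\<close>; otherwise \<open>y\<close> kills
      \<open>x \<otimes> r\<close>. Either multiple of \<open>r\<close> still has colon ideal
      \<open>B\<close>.\<close>
    proof (cases "\<exists>s\<in>?S. s \<otimes> (x \<otimes> r) \<in> A")
      case True
      then obtain s where s: "s \<in> ?S" "s \<otimes> (x \<otimes> r) \<in> A" by blast
      have "u \<otimes> (s \<otimes> r) \<notin> A" if "u \<in> ?S" for u
        using r(2)[of "u \<otimes> s"] that s rc C.S_mult C.S_carr by (simp add: m_assoc)
      then have "colon R A (s \<otimes> r) = B" using same s by blast
      moreover have "x \<in> colon R A (s \<otimes> r)"
        using s x rc by (simp add: colon_def m_lcomm)
      ultimately show ?thesis by blast
    next
      case False
      then have "colon R A (x \<otimes> r) = B" using same x by blast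
      moreover have "y \<in> colon R A (x \<otimes> r)" using y yx by (simp add: colon_def)
      ultimately show ?thesis by blast
    qed
  qed
  then show thesis using that r(1) sub unfolding B by blast
qed

section \<open>Positive height\<close>

lemma exists_smaller_prime:
  assumes "1 \<le> height R I" and "primeideal P R" and "I \<subseteq> P"
  obtains Q where "primeideal Q R" and "Q \<subset> P"
proof -
  have "1 \<le> prime_height R P"
    using assms unfolding height_def by (simp add: le_INF_iff)
  \<comment> \<open>A strict lower bound of a supremum is exceeded by some member of the set, which
    yields an actual chain; the member just below its top is the smaller prime.\<close>
  then have "0 < prime_height R P"
    by (metis not_one_le_zero zero_less_iff_neq_zero)
  then obtain n C where "0 < enat n" and C: "\<forall>i\<le>n. primeideal (C i) R"
      "\<forall>i<n. C i \<subset> C (Suc i)" "C n = P"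
    unfolding prime_height_def less_Sup_iff by blast
  from this(1) obtain k where n: "n = Suc k"
    by (cases n) (simp_all add: zero_enat_def)
  show thesis
    by (rule that[of "C k"]) (use C n in auto)
qed

section \<open>Symbolic powers\<close>

text \<open>Lying in \<open>I^t R_P\<close> amounts to having a multiplier outside \<open>P\<close>,
  so from here on only elements of \<open>R\<close> occur. The multiplier may vary with
  \<open>P\<close>.\<close>

lemma (in cring) symbolic_power_mem_iff:
  assumes "ideal I R"
  shows "r \<in> symbolic_power R I t \<longleftrightarrow> r \<in> carrier R \<and>
    (\<forall>P\<in>assoc_primes R (quot_module (self_module R) I).
      \<exists>s\<in>carrier R - P. s \<otimes> r \<in> I [^]\<^bsub>ideals_set R\<^esub> t)"
proof -
  have "loc_map R (carrier R - P) r \<in> ext_ideal R (carrier R - P) (I [^]\<^bsub>ideals_set R\<^esub> t) \<longleftrightarrow>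
      (\<exists>s\<in>carrier R - P. s \<otimes> r \<in> I [^]\<^bsub>ideals_set R\<^esub> t)"
    if "P \<in> assoc_primes R (quot_module (self_module R) I)" "r \<in> carrier R" for P
    using that
    by (intro mult_set.loc_map_mem_ext_ideal_iff primeideal.mult_set_complement
        ideal_pow_ideal[OF assms]) (auto simp: assoc_primes_def)
  then show ?thesis unfolding symbolic_power_def by blast
qed

text \<open>Two elements may need different multipliers at the same prime; the product of these
  serves the sum, since the complement of a prime is multiplicatively closed.\<close>

lemma (in cring) symbolic_power_ideal:
  assumes I: "ideal I R"
  shows "ideal (symbolic_power R I t) R"
proof (rule idealI_closed)
  interpret T: ideal "I [^]\<^bsub>ideals_set R\<^esub> t" R by (rule ideal_pow_ideal[OF I])
  note mem = symbolic_power_mem_iff[OF I]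
  have ms: "mult_set R (carrier R - P)"
    if "P \<in> assoc_primes R (quot_module (self_module R) I)" for P
    using that primeideal.mult_set_complement by (auto simp: assoc_primes_def)
  show "symbolic_power R I t \<subseteq> carrier R" using mem by blast
  show "\<zero> \<in> symbolic_power R I t"
    unfolding mem using mult_set.S_one[OF ms] T.zero_closed by (auto intro!: bexI[of _ \<one>])
  fix x assume x: "x \<in> symbolic_power R I t"
  {
    fix y assume y: "y \<in> symbolic_power R I t"
    have "\<exists>s\<in>carrier R - P. s \<otimes> (x \<oplus> y) \<in> I [^]\<^bsub>ideals_set R\<^esub> t"
      if P: "P \<in> assoc_primes R (quot_module (self_module R) I)" for P
    proof -
      obtain s u where su: "s \<in> carrier R - P" "s \<otimes> x \<in> I [^]\<^bsub>ideals_set R\<^esub> t"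
          "u \<in> carrier R - P" "u \<otimes> y \<in> I [^]\<^bsub>ideals_set R\<^esub> t"
        using x y P unfolding mem by blast
      have c: "x \<in> carrier R" "y \<in> carrier R" "s \<in> carrier R" "u \<in> carrier R"
        using x y su mem by auto
      have "(s \<otimes> u) \<otimes> (x \<oplus> y) = u \<otimes> (s \<otimes> x) \<oplus> s \<otimes> (u \<otimes> y)"
        using c by algebra
      also have "\<dots> \<in> I [^]\<^bsub>ideals_set R\<^esub> t" using su c T.I_l_closed T.a_closed by simp
      finally show ?thesis using mult_set.S_mult[OF ms[OF P]] su by blast
    qed
    then show "x \<oplus> y \<in> symbolic_power R I t"
      using x y unfolding mem by simp
  }
  fix r assume r: "r \<in> carrier R"
  have "s \<otimes> (r \<otimes> x) \<in> I [^]\<^bsub>ideals_set R\<^esub> t"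
    if "s \<in> carrier R" "s \<otimes> x \<in> I [^]\<^bsub>ideals_set R\<^esub> t" for s
    using that r x T.I_l_closed[of "s \<otimes> x" r] m_lcomm[of s r x] unfolding mem by simp
  then show "r \<otimes> x \<in> symbolic_power R I t"
    using r x unfolding mem by (meson DiffD1 m_closed)
qed

section \<open>Associated primes of the symbolic quotient\<close>

theorem theorem2p6:
  fixes R :: "('a, 'b) ring_scheme" and I :: "'a set" and t :: nat
  assumes "cring R" and "noetherian_ring R"
    and "ideal I R" and "I \<noteq> {\<zero>\<^bsub>R\<^esub>}" and "I \<noteq> carrier R"
    and "assoc_primes R (quot_module (self_module R) I) = minimal_primes R I"
    and "1 \<le> height R I"
    and "1 \<le> t"
  shows "assoc_primes R (symbolic_quotient R I t) = assoc_primes R (quot_module (self_module R) I) \<and>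
    assoc_primes R (quot_module (self_module R) I) = minimal_primes R I"
proof -
  interpret cring R by fact
  interpret I: ideal I R by fact
  let ?pow = "\<lambda>n::nat. I [^]\<^bsub>ideals_set R\<^esub> n"
  let ?sym = "symbolic_power R I"
  interpret P1: ideal "?pow (Suc t)" R by (rule ideal_pow_ideal[OF assms(3)])
  interpret S1: ideal "?sym (Suc t)" R by (rule symbolic_power_ideal[OF assms(3)])
  interpret S0: ideal "?sym t" R by (rule symbolic_power_ideal[OF assms(3)])
  \<comment> \<open>The absence of embedded primes lets the multiplier test run over the minimal
    primes of \<open>I\<close>.\<close>
  have mem: "r \<in> ?sym n \<longleftrightarrow> r \<in> carrier R \<and>
      (\<forall>P\<in>minimal_primes R I. \<exists>s\<in>carrier R - P. s \<otimes>\<^bsub>R\<^esub> r \<in> ?pow n)" for r n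
    using symbolic_power_mem_iff[OF assms(3)] unfolding assms(6) .
  have prime: "primeideal P R" if "P \<in> minimal_primes R I" for P
    using that by (simp add: minimal_primes_def)
  have sub_sym: "?pow n \<subseteq> ?sym n" for n
  proof
    fix r assume r: "r \<in> ?pow n"
    have rc: "r \<in> carrier R" using ideal.Icarr[OF ideal_pow_ideal[OF assms(3)] r] .
    then show "r \<in> ?sym n" unfolding mem
      using r mult_set.S_one[OF primeideal.mult_set_complement[OF prime]]
      by (auto intro!: bexI[of _ "\<one>\<^bsub>R\<^esub>"])
  qed
  have ass: "assoc_primes R (symbolic_quotient R I t) =
      {P. primeideal P R \<and> (\<exists>x\<in>?sym t. P = colon R (?sym (Suc t)) x)}"
    unfolding symbolic_quotient_def
    by (rule assoc_primes_quot_module[OF S1.is_ideal]) (use S0.Icarr in blast)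
  have "assoc_primes R (symbolic_quotient R I t) = minimal_primes R I"
  proof (intro equalityI subsetI)
    fix Q assume "Q \<in> assoc_primes R (symbolic_quotient R I t)"
    then obtain r where Q: "primeideal Q R" and r: "r \<in> ?sym t"
      and Qr: "Q = colon R (?sym (Suc t)) r" unfolding ass by blast
    interpret Q: primeideal Q R by fact
    have rc: "r \<in> carrier R" using r S0.Icarr by blast
    \<comment> \<open>\<open>I\<close> annihilates the symbolic quotient: a multiplier taking
      \<open>r\<close> into \<open>I ^ t\<close> takes \<open>a \<otimes> r\<close> into
      \<open>I ^ (t + 1)\<close>.\<close>
    have "I \<subseteq> Q"
    proof
      fix a assume a: "a \<in> I"
      then have ac: "a \<in> carrier R" by (rule I.Icarr)
      have "s \<otimes>\<^bsub>R\<^esub> (a \<otimes>\<^bsub>R\<^esub> r) \<in> ?pow (Suc t)" if "s \<in> carrier R" "s \<otimes>\<^bsub>R\<^esub> r \<in> ?pow t" for s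
      proof -
        have "s \<otimes>\<^bsub>R\<^esub> (a \<otimes>\<^bsub>R\<^esub> r) = (s \<otimes>\<^bsub>R\<^esub> r) \<otimes>\<^bsub>R\<^esub> a"
          using that ac rc by (simp add: m_ac)
        also have "\<dots> \<in> ideal_prod R (?pow t) I"
          using that a by (intro ideal_prod.prod)
        finally show ?thesis unfolding ideal_pow_Suc .
      qed
      then have "a \<otimes>\<^bsub>R\<^esub> r \<in> ?sym (Suc t)"
        using r m_closed[OF ac rc] unfolding mem by blast
      then show "a \<in> Q" using ac unfolding Qr colon_def by blast
    qed
    \<comment> \<open>\<open>Q\<close> is proper, so the class of \<open>r\<close> is nonzero, and
      some minimal prime \<open>P\<close> detects this.\<close>
    have "\<one>\<^bsub>R\<^esub> \<notin> Q" using Q.I_notcarr Q.one_imp_carrier by blast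
    then have "r \<notin> ?sym (Suc t)" using rc l_one[OF rc] unfolding Qr colon_def by auto
    then obtain P where P: "P \<in> minimal_primes R I"
      and not: "\<And>s. s \<in> carrier R - P \<Longrightarrow> s \<otimes>\<^bsub>R\<^esub> r \<notin> ?pow (Suc t)"
      using rc unfolding mem by blast
    have "Q \<subseteq> P"
    proof
      fix x assume "x \<in> Q"
      then have x: "x \<in> carrier R" "x \<otimes>\<^bsub>R\<^esub> r \<in> ?sym (Suc t)"
        unfolding Qr colon_def by blast+
      then obtain s where s: "s \<in> carrier R - P" "s \<otimes>\<^bsub>R\<^esub> (x \<otimes>\<^bsub>R\<^esub> r) \<in> ?pow (Suc t)"
        using P unfolding mem by blast
      then have "(s \<otimes>\<^bsub>R\<^esub> x) \<otimes>\<^bsub>R\<^esub> r \<in> ?pow (Suc t)" using x rc by (simp add: m_assoc)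
      then have "s \<otimes>\<^bsub>R\<^esub> x \<in> P" using not s x by blast
      then show "x \<in> P" using primeideal.I_prime[OF prime[OF P]] s x by blast
    qed
    then have "Q = P" using P Q \<open>I \<subseteq> Q\<close> by (simp add: minimal_primes_def)
    then show "Q \<in> minimal_primes R I" using P by simp
  next
    fix P assume P: "P \<in> minimal_primes R I"
    interpret P: primeideal P R by (rule prime[OF P])
    have IP: "I \<subseteq> P" and min: "\<And>Q. \<lbrakk>primeideal Q R; I \<subseteq> Q; Q \<subseteq> P\<rbrakk> \<Longrightarrow> Q = P"
      using P by (auto simp: minimal_primes_def)
    obtain Q where Q: "primeideal Q R" "Q \<subset> P"
      using exists_smaller_prime[OF assms(7) P.primeideal IP] .
    \<comment> \<open>By minimality of \<open>P\<close> the smaller prime does not contain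
      \<open>I\<close>, hence not \<open>I ^ t\<close>.\<close>
    then have "\<not> ?pow t \<subseteq> Q"
      using min primeideal.ideal_pow_subsetD[OF Q(1) assms(3)] by blast
    then obtain m where "m \<in> ?pow t" "\<And>s. s \<in> carrier R - P \<Longrightarrow> s \<otimes>\<^bsub>R\<^esub> m \<notin> ?pow (Suc t)"
      unfolding ideal_pow_Suc
      using exists_not_locally_mem_ideal_prod[OF assms(2) P.primeideal Q(1) _
          ideal_pow_ideal[OF assms(3)] _ assms(3) IP] Q(2) by blast
    then obtain r where r: "r \<in> ?pow t" and pr: "primeideal (colon R (?pow (Suc t)) r) R"
      and sub: "colon R (?pow (Suc t)) r \<subseteq> P"
      using exists_prime_colon[OF assms(2) P.primeideal ideal_pow_ideal[OF assms(3)] P1.is_ideal]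
      by metis
    have rc: "r \<in> carrier R" using ideal.Icarr[OF ideal_pow_ideal[OF assms(3)] r] .
    have "I \<subseteq> colon R (?pow (Suc t)) r"
    proof
      fix a assume a: "a \<in> I"
      then have "r \<otimes>\<^bsub>R\<^esub> a \<in> ?pow (Suc t)"
        unfolding ideal_pow_Suc by (intro ideal_prod.prod r)
      then show "a \<in> colon R (?pow (Suc t)) r"
        using I.Icarr[OF a] rc by (simp add: colon_def m_comm)
    qed
    then have eq: "colon R (?pow (Suc t)) r = P" using min pr sub by blast
    \<comment> \<open>Passing to the symbolic power does not enlarge the colon ideal: a multiplier
      \<open>s\<close> outside \<open>P\<close> puts \<open>s \<otimes> x\<close> in
      \<open>P\<close>, and primality removes \<open>s\<close>.\<close>
    have "colon R (?sym (Suc t)) r = P"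
    proof (intro equalityI subsetI)
      fix x assume "x \<in> P"
      then show "x \<in> colon R (?sym (Suc t)) r"
        using sub_sym unfolding eq[symmetric] colon_def by blast
    next
      fix x assume "x \<in> colon R (?sym (Suc t)) r"
      then have x: "x \<in> carrier R" "x \<otimes>\<^bsub>R\<^esub> r \<in> ?sym (Suc t)" by (auto simp: colon_def)
      then obtain s where s: "s \<in> carrier R - P" "s \<otimes>\<^bsub>R\<^esub> (x \<otimes>\<^bsub>R\<^esub> r) \<in> ?pow (Suc t)"
        using P unfolding mem by blast
      then have "s \<otimes>\<^bsub>R\<^esub> x \<in> colon R (?pow (Suc t)) r"
        using x rc by (simp add: colon_def m_assoc)
      then show "x \<in> P" using P.I_prime[of s x] s x unfolding eq by blast
    qed
    then show "P \<in> assoc_primes R (symbolic_quotient R I t)"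
      unfolding ass using r sub_sym P.primeideal by blast
  qed
  then show ?thesis using assms(6) by simp
qed

end
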